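(* Let $n\ge 1$ be an integer, let $q_0=1$ and $0<q_i<1$ for $i=1,\dots,n$, and let $a_i\ge 0$ for $i=0,1,\dots,n$. Then the function $\mathcal{R}(\bar a;\bar q;x)$ satisfies $$e^{a_0x}\le \mathcal{R}(\bar a;\bar q;x)\le e^{\left(\sum_{i=0}^n a_i\right)x},\qquad 0\le x<\infty.$$
   Context: Notation: $\bar a=(a_0,\dots,a_n)$, $\bar q=(q_0,\dots,q_n)$, and $(\bar a;\bar q)_m=\prod_{j=0}^{m-1}\left(\sum_{i=0}^n a_iq_i^j\right)$ for $m\ge 1$, with $(\bar a;\bar q)_0=1$. The special function $\mathcal{R}$ is defined by the (everywhere convergent) power series $\mathcal{R}(\bar a;\bar q;x)=\sum_{m=0}^\infty \frac{x^m}{m!}(\bar a;\bar q)_m$. *)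

theory Defs
  imports Complex_Main
begin

(* The tuples (a_0,...,a_n) and (q_0,...,q_n) are functions on nat of which only the
   values at indices 0,...,n matter. *)

definition qpoch :: "nat \<Rightarrow> (nat \<Rightarrow> 'a) \<Rightarrow> (nat \<Rightarrow> 'a) \<Rightarrow> nat \<Rightarrow> 'a::comm_semiring_1"
  where "qpoch n a q m = (\<Prod>j<m. \<Sum>i\<le>n. a i * q i ^ j)"

definition R_fun ::
  "nat \<Rightarrow> (nat \<Rightarrow> 'a) \<Rightarrow> (nat \<Rightarrow> 'a) \<Rightarrow> 'a \<Rightarrow> 'a::{real_normed_field, banach}"
  where "R_fun n a q x = (\<Sum>m. x ^ m / fact m * qpoch n a q m)"

end

theory Submission
  imports Defs
begin

text \<open>
  Since \<open>q 0 = 1\<close> and every \<open>q i\<close> lies in the unit interval, each factor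
  \<open>\<Sum>i\<le>n. a i * q i ^ j\<close> of the generalised Pochhammer product is at least its term
  \<open>a 0\<close> and at most the sum \<open>S\<close> of all \<open>a i\<close>. Hence the product of \<open>m\<close> factors lies between
  \<open>a 0 ^ m\<close> and \<open>S ^ m\<close>, and the power series of \<open>R_fun\<close> lies, term by term, between the
  exponential series of \<open>a 0 * x\<close> and \<open>S * x\<close> when \<open>x \<ge> 0\<close>. The upper one also gives
  convergence by comparison.
\<close>

lemma qpoch_factor_bounds:
  fixes a q :: "nat \<Rightarrow> real"
  assumes "q 0 = 1"
    and q: "\<And>i. i \<le> n \<Longrightarrow> 0 \<le> q i \<and> q i \<le> 1"
    and a: "\<And>i. i \<le> n \<Longrightarrow> 0 \<le> a i"
  shows "a 0 \<le> (\<Sum>i\<le>n. a i * q i ^ j)"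
    and "(\<Sum>i\<le>n. a i * q i ^ j) \<le> (\<Sum>i\<le>n. a i)"
proof -
  have "a 0 * q 0 ^ j \<le> (\<Sum>i\<le>n. a i * q i ^ j)"
    using a q by (intro member_le_sum) auto
  with \<open>q 0 = 1\<close> show "a 0 \<le> (\<Sum>i\<le>n. a i * q i ^ j)" by simp
  show "(\<Sum>i\<le>n. a i * q i ^ j) \<le> (\<Sum>i\<le>n. a i)"
    using a q by (intro sum_mono) (auto intro!: mult_left_le power_le_one)
qed

lemma qpoch_bounds:
  fixes a q :: "nat \<Rightarrow> real"
  assumes "q 0 = 1"
    and "\<And>i. i \<le> n \<Longrightarrow> 0 \<le> q i \<and> q i \<le> 1"
    and a: "\<And>i. i \<le> n \<Longrightarrow> 0 \<le> a i"
  shows "a 0 ^ m \<le> qpoch n a q m" and "qpoch n a q m \<le> (\<Sum>i\<le>n. a i) ^ m"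
proof -
  note factor = qpoch_factor_bounds[where a = a and q = q and n = n, OF assms]
  have "0 \<le> a 0" using a by simp
  have "(\<Prod>j<m. a 0) \<le> qpoch n a q m"
    unfolding qpoch_def by (intro prod_mono conjI \<open>0 \<le> a 0\<close> factor(1))
  then show "a 0 ^ m \<le> qpoch n a q m" by simp
  have "qpoch n a q m \<le> (\<Prod>j<m. \<Sum>i\<le>n. a i)"
    unfolding qpoch_def
    by (intro prod_mono conjI factor(2) order_trans[OF \<open>0 \<le> a 0\<close> factor(1)])
  then show "qpoch n a q m \<le> (\<Sum>i\<le>n. a i) ^ m" by simp
qed

lemma exp_mult_sums:
  fixes c x :: real
  shows "(\<lambda>m. x ^ m / fact m * c ^ m) sums exp (c * x)"
  using exp_converges[of "c * x"]
  by (simp add: power_mult_distrib divide_inverse mult_ac)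

text \<open>
  Geometric coefficients \<open>c ^ m\<close> turn this series into an exponential, so a termwise comparison of
  sums suffices once the middle series converges. Nonnegativity of \<open>c\<close> makes \<open>p\<close> nonnegative, so
  that the series of \<open>exp (d * x)\<close> dominates the absolute values of the terms.
\<close>

lemma exp_le_suminf_le_exp:
  fixes p :: "nat \<Rightarrow> real"
  assumes "0 \<le> c" and lower: "\<And>m. c ^ m \<le> p m" and upper: "\<And>m. p m \<le> d ^ m" and "0 \<le> x"
  shows "exp (c * x) \<le> (\<Sum>m. x ^ m / fact m * p m)"
    and "(\<Sum>m. x ^ m / fact m * p m) \<le> exp (d * x)"
proof -
  have nonneg: "0 \<le> x ^ m / fact m" for m
    using \<open>0 \<le> x\<close> by simp
  have "0 \<le> p m" for m
    using zero_le_power[OF \<open>0 \<le> c\<close>] lower by (rule order_trans)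
  then have "norm (x ^ m / fact m * p m) = x ^ m / fact m * p m" for m
    unfolding real_norm_def by (intro abs_of_nonneg mult_nonneg_nonneg nonneg)
  then have "norm (x ^ m / fact m * p m) \<le> x ^ m / fact m * d ^ m" for m
    by (metis mult_left_mono[OF upper nonneg])
  then have "summable (\<lambda>m. x ^ m / fact m * p m)"
    by (intro summable_comparison_test'[OF sums_summable[OF exp_mult_sums]])
  then have p_sums: "(\<lambda>m. x ^ m / fact m * p m) sums (\<Sum>m. x ^ m / fact m * p m)"
    by (rule summable_sums)
  show "exp (c * x) \<le> (\<Sum>m. x ^ m / fact m * p m)"
    by (rule sums_le[OF _ exp_mult_sums p_sums]) (intro mult_left_mono lower nonneg)
  show "(\<Sum>m. x ^ m / fact m * p m) \<le> exp (d * x)"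
    by (rule sums_le[OF _ p_sums exp_mult_sums]) (intro mult_left_mono upper nonneg)
qed

theorem theorem6p5:
  fixes n :: nat and a q :: "nat \<Rightarrow> real" and x :: real
  assumes "n \<ge> 1"
    and "q 0 = 1"
    and "\<And>i. 1 \<le> i \<Longrightarrow> i \<le> n \<Longrightarrow> 0 < q i \<and> q i < 1"
    and "\<And>i. i \<le> n \<Longrightarrow> a i \<ge> 0"
    and "0 \<le> x"
  shows "exp (a 0 * x) \<le> R_fun n a q x \<and> R_fun n a q x \<le> exp ((\<Sum>i\<le>n. a i) * x)"
proof -
  have q: "0 \<le> q i \<and> q i \<le> 1" if "i \<le> n" for i
  proof (cases "i = 0")
    case True
    then show ?thesis using assms(2) by simp
  next
    case False
    then show ?thesis using assms(3)[of i] that by simp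
  qed
  have "0 \<le> a 0" using assms(4) by simp
  note bounds = qpoch_bounds[where a = a and q = q and n = n, OF assms(2) q assms(4)]
  show ?thesis
    unfolding R_fun_def
    by (intro conjI exp_le_suminf_le_exp[OF \<open>0 \<le> a 0\<close> bounds \<open>0 \<le> x\<close>])
qed

end
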